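(* Let $(X,p,E)$ be an $op$-continuous lattice-normed Riesz space. Then every statistically order convergent sequence in $X$ is statistically unbounded $p$-convergent in $(X,p,E)$.
   Context: All Riesz spaces (vector lattices) are real and Archimedean; sequences are indexed by the positive integers $\mathbb{N}$; $E_+$ and $X_+$ denote positive cones. A sequence $(a_n)$ in a Riesz space is order convergent to $a$, written $a_n\xrightarrow{o}a$, if there is a sequence $(q_n)$ in that space, decreasing with infimum $0$, such that $|a_n-a|\le q_n$ for all $n$. A lattice-normed Riesz space $(X,p,E)$ consists of Riesz spaces $X$ and $E$ and a map $p:X\to E_+$ with $p(x)=0\Leftrightarrow x=0$, $p(\lambda x)=|\lambda|p(x)$ for $\lambda\in\mathbb{R}$, $p(x+y)\le p(x)+p(y)$, which is monotone: $|x|\le|y|$ implies $p(x)\le p(y)$. It is $op$-continuous if, for sequences $(x_n)$ in $X$, $x_n\xrightarrow{o}0$ in $X$ implies $p(x_n)\xrightarrow{o}0$ in $E$. The natural density of $K\subseteq\mathbb{N}$ is $\delta(K)=\lim_{n}\frac1n|\{k\le n:k\in K\}|$. A sequence $(q_n)$ in a Riesz space is statistically order decreasing to $0$, written $q_n\downarrow^{st}0$, if there is $K\subseteq\mathbb{N}$ with $\delta(K)=1$ such that $(q_k)_{k\in K}$ is decreasing and $\inf_{k\in K}q_k=0$. A sequence $(x_n)$ in $X$ is statistically order convergent to $x\in X$ if there exist $q_n\downarrow^{st}0$ in $X$ and $K\subseteq\mathbb{N}$ with $\delta(K)=1$ such that $|x_k-x|\le q_k$ for all $k\in K$. A sequence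 $(x_n)$ in $X$ is statistically unbounded $p$-convergent ($st$-$up$-convergent) to $x\in X$ if for every $u\in X_+$ there exist a sequence $q_n\downarrow^{st}0$ in $E$ and a set $K\subseteq\mathbb{N}$ with $\delta(K)=1$ such that $p(|x_k-x|\wedge u)\le q_k$ for all $k\in K$. A sequence is called convergent in one of these senses if it converges in that sense to some element of $X$. *)

theory Defs
  imports "HOL-Analysis.Analysis" "HOL-Library.Lattice_Algebras" "HOL-Library.Lub_Glb"
begin

class riesz_space = ordered_real_vector + lattice_ab_group_add_abs

class archimedean_riesz_space = riesz_space +
  assumes archimedean: "(\<And>n::nat. real n *\<^sub>R x \<le> y) \<Longrightarrow> x \<le> 0"

text \<open>Sequences are functions on \<^typ>\<open>nat\<close> of which only the values at positive indices are used;
  correspondingly, natural density is considered for sets of positive integers.\<close>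

definition has_natural_density :: "nat set \<Rightarrow> real \<Rightarrow> bool" where
  "has_natural_density K d \<longleftrightarrow> K \<subseteq> {1..} \<and>
     (\<lambda>n. real (card {k. k \<le> n \<and> k \<in> K}) / real n) \<longlonglongrightarrow> d"

definition decreasing_to_zero_on :: "nat set \<Rightarrow> (nat \<Rightarrow> 'a::archimedean_riesz_space) \<Rightarrow> bool" where
  "decreasing_to_zero_on K q \<longleftrightarrow> antimono_on K q \<and> isGlb UNIV (q ` K) 0"

definition order_converges :: "(nat \<Rightarrow> 'a::archimedean_riesz_space) \<Rightarrow> 'a \<Rightarrow> bool" where
  "order_converges a l \<longleftrightarrow>
     (\<exists>q. decreasing_to_zero_on {1..} q \<and> (\<forall>n\<ge>1. \<bar>a n - l\<bar> \<le> q n))"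

definition st_decreasing_to_zero :: "(nat \<Rightarrow> 'a::archimedean_riesz_space) \<Rightarrow> bool" where
  "st_decreasing_to_zero q \<longleftrightarrow> (\<exists>K. has_natural_density K 1 \<and> decreasing_to_zero_on K q)"

definition st_order_converges :: "(nat \<Rightarrow> 'a::archimedean_riesz_space) \<Rightarrow> 'a \<Rightarrow> bool" where
  "st_order_converges x l \<longleftrightarrow>
     (\<exists>q K. st_decreasing_to_zero q \<and> has_natural_density K 1 \<and> (\<forall>k\<in>K. \<bar>x k - l\<bar> \<le> q k))"

locale lattice_normed_riesz_space =
  fixes p :: "'x::archimedean_riesz_space \<Rightarrow> 'e::archimedean_riesz_space"
  assumes nonneg: "0 \<le> p x"
    and eq_zero_iff: "p x = 0 \<longleftrightarrow> x = 0"
    and scaleR: "p (c *\<^sub>R x) = \<bar>c\<bar> *\<^sub>R p x"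
    and triangle: "p (x + y) \<le> p x + p y"
    and monotone: "\<bar>x\<bar> \<le> \<bar>y\<bar> \<Longrightarrow> p x \<le> p y"

definition op_continuous ::
    "('x::archimedean_riesz_space \<Rightarrow> 'e::archimedean_riesz_space) \<Rightarrow> bool" where
  "op_continuous p \<longleftrightarrow>
     (\<forall>x. order_converges x 0 \<longrightarrow> order_converges (\<lambda>n. p (x n)) 0)"

definition st_up_converges ::
    "('x::archimedean_riesz_space \<Rightarrow> 'e::archimedean_riesz_space) \<Rightarrow> (nat \<Rightarrow> 'x) \<Rightarrow> 'x \<Rightarrow> bool" where
  "st_up_converges p x l \<longleftrightarrow>
     (\<forall>u\<ge>0. \<exists>q K. st_decreasing_to_zero q \<and> has_natural_density K 1 \<and>
        (\<forall>k\<in>K. p (inf \<bar>x k - l\<bar> u) \<le> q k))"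

end

theory Submission
  imports Defs
begin

text \<open>If \<open>q\<close> decreases to \<open>0\<close> along an infinite set \<open>J\<close>, the enumeration of \<open>q\<close> along \<open>J\<close> order
  converges to \<open>0\<close>. By \<open>op\<close>-continuity so does its image under \<open>p\<close>, and as that image is decreasing,
  its infimum is \<open>0\<close>. Hence \<open>p \<circ> q\<close> is itself a statistically decreasing bound for
  \<open>p (\<bar>x k - l\<bar> \<and> u)\<close>.\<close>

lemma isGlb_UNIV_iff:
  "isGlb UNIV S a \<longleftrightarrow> (\<forall>s\<in>S. a \<le> s) \<and> (\<forall>b. (\<forall>s\<in>S. b \<le> s) \<longrightarrow> b \<le> a)"
  by (auto simp: isGlb_def isLb_def greatestP_def setge_def setle_def)

lemma decreasing_to_zero_on_nonneg: "decreasing_to_zero_on K q \<Longrightarrow> k \<in> K \<Longrightarrow> 0 \<le> q k"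
  by (auto simp: decreasing_to_zero_on_def isGlb_UNIV_iff)

text \<open>The counts of a finite set stay below \<open>card K\<close>, so dividing by
  \<open>n\<close> forces density 0. Infinitude lets \<open>enumerate\<close> list the whole set as
  a sequence.\<close>

lemma has_natural_density_infinite:
  assumes "has_natural_density K d" and "d \<noteq> 0"
  shows "infinite K"
proof
  assume fin: "finite K"
  have "(\<lambda>n. real (card {k. k \<le> n \<and> k \<in> K}) / real n) \<longlonglongrightarrow> 0"
  proof (rule tendsto_sandwich)
    show "\<forall>\<^sub>F n in sequentially. real (card {k. k \<le> n \<and> k \<in> K}) / real n \<le> real (card K) / real n"
      using fin by (intro always_eventually allI divide_right_mono) (auto intro!: card_mono)
    show "\<forall>\<^sub>F n in sequentially. 0 \<le> real (card {k. k \<le> n \<and> k \<in> K}) / real n"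
      by simp
  qed (auto intro!: lim_const_over_n)
  then show False
    using assms LIMSEQ_unique unfolding has_natural_density_def by blast
qed

lemma order_converges_enumerate:
  assumes dec: "decreasing_to_zero_on J q" and inf: "infinite J"
  shows "order_converges (\<lambda>n. q (enumerate J (n - 1))) 0"
proof -
  \<comment> \<open>Sequences start at index 1 but \<open>enumerate\<close> starts at 0, hence the
    shift \<open>n - 1\<close>.\<close>
  let ?y = "\<lambda>n. q (enumerate J (n - 1))"
  have in_J: "enumerate J n \<in> J" for n
    using inf by (rule enumerate_in_set)
  have "antimono_on {1..} ?y"
    using dec inf in_J
    by (auto simp: decreasing_to_zero_on_def monotone_on_def enumerate_mono_le_iff)
  \<comment> \<open>Equal ranges have equal infima, so \<open>?y\<close> inherits the infimum 0 from
    \<open>q\<close> on \<open>J\<close>.\<close>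
  moreover have "?y ` {1..} = q ` J"
  proof -
    have "(\<lambda>n. n - 1) ` {1..} = (UNIV :: nat set)"
      by (auto simp: image_iff intro!: bexI[of _ "Suc _"])
    then have "enumerate J ` (\<lambda>n. n - 1) ` {1..} = J"
      using range_enumerate[OF inf] by simp
    then show ?thesis
      by (metis image_image)
  qed
  moreover have "\<bar>?y n - 0\<bar> \<le> ?y n" for n
    using decreasing_to_zero_on_nonneg[OF dec in_J] by simp
  ultimately show ?thesis
    using dec unfolding order_converges_def decreasing_to_zero_on_def by metis
qed

context lattice_normed_riesz_space
begin

lemma decreasing_to_zero_on_comp:
  assumes op: "op_continuous p" and dec: "decreasing_to_zero_on J q" and inf: "infinite J"
  shows "decreasing_to_zero_on J (\<lambda>k. p (q k))"
proof -
  have "order_converges (\<lambda>n. p (q (enumerate J (n - 1)))) 0"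
    using op order_converges_enumerate[OF dec inf] by (auto simp: op_continuous_def)
  then obtain r where r: "decreasing_to_zero_on {1..} r"
    and le_r: "\<And>n. n \<ge> 1 \<Longrightarrow> p (q (enumerate J (n - 1))) \<le> r n"
    using nonneg by (auto simp: order_converges_def)
  have "antimono_on J (\<lambda>k. p (q k))"
  proof (rule monotone_onI)
    fix i j
    assume "i \<in> J" "j \<in> J" "i \<le> j"
    \<comment> \<open>Monotonicity of \<open>p\<close> compares absolute values; since
      \<open>q\<close> is nonnegative on \<open>J\<close>, these are the values of \<open>q\<close>
      themselves.\<close>
    then show "p (q j) \<le> p (q i)"
      using dec decreasing_to_zero_on_nonneg[OF dec]
      by (intro monotone) (auto simp: decreasing_to_zero_on_def monotone_on_def)
  qed
  moreover have "b \<le> 0" if b: "\<forall>k\<in>J. b \<le> p (q k)" for b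
  proof -
    \<comment> \<open>The sequence \<open>r\<close> dominates \<open>p\<close> of \<open>q\<close>
      along the enumeration, so \<open>b\<close> is also a lower bound of \<open>r\<close>, whose
      infimum is 0.\<close>
    have "b \<le> r n" if "n \<ge> 1" for n
      using b le_r[OF that] enumerate_in_set[OF inf] order_trans by blast
    then show ?thesis
      using r by (auto simp: decreasing_to_zero_on_def isGlb_UNIV_iff)
  qed
  ultimately show ?thesis
    using nonneg by (auto simp: decreasing_to_zero_on_def isGlb_UNIV_iff)
qed

lemma st_order_converges_imp_st_up_converges:
  assumes op: "op_continuous p" and x: "st_order_converges x l"
  shows "st_up_converges p x l"
  unfolding st_up_converges_def
proof (intro allI impI)
  fix u :: 'x
  assume u: "0 \<le> u"
  \<comment> \<open>The domination holds on \<open>K\<close> and the decrease on \<open>J\<close>.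
    The two sets may differ and are never intersected: \<open>J\<close> serves the new bound
    \<open>p (q k)\<close>, \<open>K\<close> the new estimate.\<close>
  obtain q K J where K: "has_natural_density K 1" and q: "\<And>k. k \<in> K \<Longrightarrow> \<bar>x k - l\<bar> \<le> q k"
    and J: "has_natural_density J 1" and dec: "decreasing_to_zero_on J q"
    using x by (auto simp: st_order_converges_def st_decreasing_to_zero_def)
  have "infinite J"
    using has_natural_density_infinite[OF J] by simp
  then have "st_decreasing_to_zero (\<lambda>k. p (q k))"
    using J decreasing_to_zero_on_comp[OF op dec] by (auto simp: st_decreasing_to_zero_def)
  moreover have "p (inf \<bar>x k - l\<bar> u) \<le> p (q k)" if "k \<in> K" for k
  proof (rule monotone)
    have "\<bar>inf \<bar>x k - l\<bar> u\<bar> = inf \<bar>x k - l\<bar> u"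
      using u by (intro abs_of_nonneg) simp
    also have "\<dots> \<le> q k"
      using q[OF that] by (rule le_infI1)
    also have "\<dots> \<le> \<bar>q k\<bar>"
      by (rule abs_ge_self)
    finally show "\<bar>inf \<bar>x k - l\<bar> u\<bar> \<le> \<bar>q k\<bar>" .
  qed
  ultimately show "\<exists>q K. st_decreasing_to_zero q \<and> has_natural_density K 1 \<and>
      (\<forall>k\<in>K. p (inf \<bar>x k - l\<bar> u) \<le> q k)"
    using K by blast
qed

end

theorem proposition4p5:
  fixes p :: "'x::archimedean_riesz_space \<Rightarrow> 'e::archimedean_riesz_space"
    and x :: "nat \<Rightarrow> 'x"
  assumes "lattice_normed_riesz_space p"
    and "op_continuous p"
    and "\<exists>l. st_order_converges x l"
  shows "\<exists>l. st_up_converges p x l"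
  using assms lattice_normed_riesz_space.st_order_converges_imp_st_up_converges by blast

end
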